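(* Let $V_g>0$ and $k_G>0$, and consider the scalar ordinary differential equation $$\dot e=-V_g\tanh(k_G e),\qquad e(t)\in\mathbb{R}.$$ Then: (1) For every initial condition $e(0)=e_0\in\mathbb{R}$, a unique solution $e(t)$ exists for all $t\ge 0$. (2) The equilibrium $e=0$ is globally asymptotically stable. (3) Every solution evolves monotonically toward zero without overshoot, i.e. $e(t)$ is monotone in $t$, tends to $0$ as $t\to\infty$, and does not change sign.
   Context: Here $e$ is the standoff error of a vehicle relative to a desired curve, $V_g$ is its constant ground speed, and $k_G$ is a guidance gain. Global asymptotic stability of $e=0$ means Lyapunov stability together with $e(t)\to 0$ as $t\to\infty$ for every initial condition $e_0\in\mathbb{R}$. *)

theory Defs
  imports "HOL-Analysis.Analysis"
begin

text \<open>Classical solution of the scalar autonomous equation \<open>x' = f x\<close> on a time set \<open>I\<close>. The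
  derivative is taken within \<open>I\<close>, so it is one-sided at an endpoint of an interval. Values of \<open>x\<close>
  outside \<open>I\<close> are irrelevant.\<close>

definition ode_solution_on :: "(real \<Rightarrow> real) \<Rightarrow> real set \<Rightarrow> (real \<Rightarrow> real) \<Rightarrow> bool" where
  "ode_solution_on f I x \<longleftrightarrow> (\<forall>t\<in>I. (x has_real_derivative f (x t)) (at t within I))"

text \<open>Uniqueness is required among all forward solutions, including those that are only
  defined on a subinterval of \<open>[0, \<infinity>)\<close> containing \<open>0\<close>; taking \<open>I = {0..}\<close> gives uniqueness among
  global solutions.\<close>

definition has_unique_global_solution :: "(real \<Rightarrow> real) \<Rightarrow> real \<Rightarrow> bool" where
  "has_unique_global_solution f x0 \<longleftrightarrow>
     (\<exists>x. ode_solution_on f {0..} x \<and> x 0 = x0 \<and>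
        (\<forall>I y. is_interval I \<and> 0 \<in> I \<and> I \<subseteq> {0..} \<and> ode_solution_on f I y \<and> y 0 = x0
           \<longrightarrow> (\<forall>t\<in>I. y t = x t)))"

definition lyapunov_stable :: "(real \<Rightarrow> real) \<Rightarrow> real \<Rightarrow> bool" where
  "lyapunov_stable f p \<longleftrightarrow>
     (\<forall>\<epsilon>>0. \<exists>\<delta>>0. \<forall>x. ode_solution_on f {0..} x \<and> \<bar>x 0 - p\<bar> < \<delta> \<longrightarrow> (\<forall>t\<ge>0. \<bar>x t - p\<bar> < \<epsilon>))"

text \<open>Stability and attractivity quantify over solutions on \<open>[0, \<infinity>)\<close>, so these notions are
  meaningful for vector fields whose initial value problems are all globally solvable.\<close>

definition globally_asymptotically_stable :: "(real \<Rightarrow> real) \<Rightarrow> real \<Rightarrow> bool" where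
  "globally_asymptotically_stable f p \<longleftrightarrow>
     f p = 0 \<and> lyapunov_stable f p \<and>
     (\<forall>x. ode_solution_on f {0..} x \<longrightarrow> (x \<longlongrightarrow> p) at_top)"

end

theory Submission
  imports Defs
begin

text \<open>Along a solution, \<open>sinh (k e)\<close> satisfies the linear equation \<open>s' = - k V s\<close>, because
  \<open>cosh (k e) tanh (k e) = sinh (k e)\<close>. Hence every solution is given by
  \<open>sinh (k e(t)) = exp (- k V t) sinh (k e(0))\<close>, from which all claims can be read off.\<close>

text \<open>The closed form solved for e, with \<open>c\<close> the value at time 0. Since
  \<open>arsinh\<close> is defined on all reals, the formula never breaks down, so existence is
  global.\<close>

definition tanh_flow :: "real \<Rightarrow> real \<Rightarrow> real \<Rightarrow> real \<Rightarrow> real" where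
  "tanh_flow V k c t = arsinh (sinh (k * c) * exp (- (k * V * t))) / k"

lemma tanh_flow_0 [simp]: "k \<noteq> 0 \<Longrightarrow> tanh_flow V k c 0 = c"
  by (simp add: tanh_flow_def arsinh_sinh_real)

lemma sinh_tanh_flow: "k \<noteq> 0 \<Longrightarrow> sinh (k * tanh_flow V k c t) = sinh (k * c) * exp (- (k * V * t))"
  by (simp add: tanh_flow_def)

text \<open>The chain rule gives the derivative - V s / sqrt (s^2 + 1) with s = sinh (k e), and this
  quotient is tanh (k e) because cosh is the positive root of 1 + sinh^2.\<close>

lemma tanh_flow_solution:
  assumes "k \<noteq> 0"
  shows "ode_solution_on (\<lambda>e. - V * tanh (k * e)) I (tanh_flow V k c)"
  unfolding ode_solution_on_def
proof
  fix t
  define s where "s = sinh (k * c) * exp (- (k * V * t))"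
  have s: "sinh (k * tanh_flow V k c t) = s"
    using sinh_tanh_flow[OF assms] by (simp add: s_def)
  then have "cosh (k * tanh_flow V k c t) = sqrt (s\<^sup>2 + 1)"
    by (metis cosh_real_nonneg cosh_square_eq real_sqrt_unique)
  with s have tanh: "tanh (k * tanh_flow V k c t) = s / sqrt (s\<^sup>2 + 1)"
    by (simp add: tanh_def)
  have "((\<lambda>t. sinh (k * c) * exp (- (k * V * t))) has_real_derivative - (k * V * s)) (at t within I)"
    by (auto intro!: derivative_eq_intros simp: s_def)
  from DERIV_chain'[OF this arsinh_real_has_field_derivative]
  have "((\<lambda>t. arsinh (sinh (k * c) * exp (- (k * V * t)))) has_real_derivative
      1 / sqrt (s\<^sup>2 + 1) * - (k * V * s)) (at t within I)"
    by (simp add: s_def)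
  from DERIV_cdivide[OF this, of k]
  show "(tanh_flow V k c has_real_derivative - V * tanh (k * tanh_flow V k c t)) (at t within I)"
    unfolding tanh using assms by (simp add: tanh_flow_def[abs_def] mult.assoc)
qed

text \<open>Integrating factor: sinh (k y) exp (k V t) is constant along a solution, and sinh is
  injective. Allowing any interval around 0 covers uniqueness of local solutions too.\<close>

lemma ode_solution_eq_tanh_flow:
  assumes "k \<noteq> 0" and I: "is_interval I" "0 \<in> I" "t \<in> I"
    and sol: "ode_solution_on (\<lambda>e. - V * tanh (k * e)) I y"
  shows "y t = tanh_flow V k (y 0) t"
proof -
  have "((\<lambda>t. sinh (k * y t) * exp (k * V * t)) has_real_derivative 0) (at t within I)"
    if "t \<in> I" for t
  proof -
    have "(y has_real_derivative - V * tanh (k * y t)) (at t within I)"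
      using sol that by (simp add: ode_solution_on_def)
    \<comment> \<open>Cancelling cosh turns cosh tanh into sinh, so the two terms of the product
      rule add up to 0.\<close>
    moreover have "cosh (k * y t) \<noteq> 0"
      by simp
    ultimately show ?thesis
      by (auto intro!: derivative_eq_intros simp: tanh_def)
  qed
  then obtain C where C: "\<And>t. t \<in> I \<Longrightarrow> sinh (k * y t) * exp (k * V * t) = C"
    using has_field_derivative_zero_constant[of I "\<lambda>t. sinh (k * y t) * exp (k * V * t)"] I(1)
    by (metis is_interval_convex)
  have "sinh (k * y t) * exp (k * V * t) = sinh (k * y 0)"
    using C[OF I(2)] C[OF I(3)] by simp
  then have "sinh (k * y t) = sinh (k * y 0) * exp (- (k * V * t))"
    by (simp add: exp_minus field_simps)
  then show ?thesis
    using assms(1) by (metis arsinh_sinh_real nonzero_mult_div_cancel_left tanh_flow_def)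
qed

context
  fixes V k :: real
  assumes V: "V > 0" and k: "k > 0"
begin

text \<open>For k > 0, sinh (k x) has the sign of x, and the exponential factor is positive. This
  rules out overshoot.\<close>

lemma sgn_tanh_flow: "sgn (tanh_flow V k c t) = sgn c"
proof -
  have sgn_sinh: "sgn (sinh (k * x)) = sgn x" for x
    using k by (auto simp: sgn_real_def zero_less_mult_iff)
  have "sgn (sinh (k * tanh_flow V k c t)) = sgn (sinh (k * c))"
    using k by (simp add: sinh_tanh_flow sgn_mult)
  then show ?thesis
    by (simp only: sgn_sinh)
qed

text \<open>A nonnegative multiple of a decaying exponential decreases, and the increasing function
  sinh reflects this order.\<close>

lemma tanh_flow_antimono:
  assumes "c \<ge> 0"
  shows "antimono (tanh_flow V k c)"
proof (rule antimonoI)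
  fix s t :: real
  assume "s \<le> t"
  then have "sinh (k * c) * exp (- (k * V * t)) \<le> sinh (k * c) * exp (- (k * V * s))"
    using assms V k by (intro mult_left_mono) auto
  then have "sinh (k * tanh_flow V k c t) \<le> sinh (k * tanh_flow V k c s)"
    using k by (simp add: sinh_tanh_flow)
  then show "tanh_flow V k c t \<le> tanh_flow V k c s"
    using k by simp
qed

text \<open>Oddness of sinh and \<open>arsinh\<close>; it reduces \<open>c \<le> 0\<close> to the
  nonnegative case.\<close>

lemma tanh_flow_minus: "tanh_flow V k (- c) t = - tanh_flow V k c t"
  by (simp add: tanh_flow_def)

lemma tanh_flow_mono:
  assumes "c \<le> 0"
  shows "mono (tanh_flow V k c)"
  using tanh_flow_antimono[of "- c"] assms by (simp add: monotone_def tanh_flow_minus)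

text \<open>Monotonicity and the preserved sign keep the value between 0 and c.\<close>

lemma abs_tanh_flow_le:
  assumes "t \<ge> 0"
  shows "\<bar>tanh_flow V k c t\<bar> \<le> \<bar>c\<bar>"
proof (cases "c \<ge> 0")
  case True
  then show ?thesis
    using antimonoD[OF tanh_flow_antimono assms, of c] sgn_tanh_flow[of c t] k
    by (auto simp: sgn_real_def split: if_splits)
next
  case False
  then show ?thesis
    using monoD[OF tanh_flow_mono assms, of c] sgn_tanh_flow[of c t] k
    by (auto simp: sgn_real_def split: if_splits)
qed

lemma tanh_flow_tendsto_0: "(tanh_flow V k c \<longlongrightarrow> 0) at_top"
proof -
  have "filterlim (\<lambda>t. - (k * V * t)) at_bot at_top"
    using V k by (intro filterlim_uminus_at_bot_at_top[THEN filterlim_compose]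
        filterlim_tendsto_pos_mult_at_top[OF tendsto_const]) (auto intro: filterlim_ident)
  then have "((\<lambda>t. exp (- (k * V * t))) \<longlongrightarrow> 0) at_top"
    by (rule filterlim_compose[OF exp_at_bot])
  then have "((\<lambda>t. arsinh (sinh (k * c) * exp (- (k * V * t))) / k) \<longlongrightarrow>
      arsinh (sinh (k * c) * 0) / k) at_top"
    using k by (intro tendsto_intros) auto
  then show ?thesis
    by (simp add: tanh_flow_def[abs_def])
qed

end

theorem theorem2:
  fixes V_g k_G :: real and F :: "real \<Rightarrow> real"
  assumes "V_g > 0" and "k_G > 0"
    and F: "F = (\<lambda>e. - V_g * tanh (k_G * e))"
  shows "(\<forall>e0. has_unique_global_solution F e0) \<and>
    globally_asymptotically_stable F 0 \<and>
    (\<forall>e. ode_solution_on F {0..} e \<longrightarrow>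
       (mono_on {0..} e \<or> antimono_on {0..} e) \<and>
       (e \<longlongrightarrow> 0) at_top \<and>
       (\<forall>t\<ge>0. sgn (e t) = sgn (e 0)))"
proof -
  let ?\<phi> = "tanh_flow V_g k_G"
  have "has_unique_global_solution F e0" for e0
    unfolding has_unique_global_solution_def
  proof (intro exI conjI allI impI ballI)
    show "ode_solution_on F {0..} (?\<phi> e0)" "?\<phi> e0 0 = e0"
      using tanh_flow_solution[of k_G V_g] assms by auto
    show "y t = ?\<phi> e0 t"
      if "is_interval I \<and> 0 \<in> I \<and> I \<subseteq> {0..} \<and> ode_solution_on F I y \<and> y 0 = e0" "t \<in> I" for I y t
      using ode_solution_eq_tanh_flow[of k_G I t V_g y] that assms(2) by (simp add: F)
  qed
  \<comment> \<open>The final bound on \<bar>e t\<bar> is added for Lyapunov stability.\<close>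
  moreover have props: "(mono_on {0..} e \<or> antimono_on {0..} e) \<and> (e \<longlongrightarrow> 0) at_top \<and>
      (\<forall>t\<ge>0. sgn (e t) = sgn (e 0)) \<and> (\<forall>t\<ge>0. \<bar>e t\<bar> \<le> \<bar>e 0\<bar>)"
    if sol: "ode_solution_on F {0..} e" for e
  proof -
    define c where "c = e 0"
    have e: "e t = ?\<phi> c t" if "t \<ge> 0" for t
      unfolding c_def using sol that assms by (intro ode_solution_eq_tanh_flow) auto
    have "mono (?\<phi> c) \<or> antimono (?\<phi> c)"
      using tanh_flow_mono[OF assms(1,2)] tanh_flow_antimono[OF assms(1,2)] by (meson linear)
    then have "mono_on {0..} e \<or> antimono_on {0..} e"
      by (auto simp: monotone_on_def e)
    \<comment> \<open>At negative times e is arbitrary, so the limit is transferred through eventual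
      equality.\<close>
    moreover have "\<forall>\<^sub>F t in at_top. ?\<phi> c t = e t"
      using eventually_ge_at_top[of 0] by eventually_elim (simp add: e)
    with tanh_flow_tendsto_0[OF assms(1,2)] have "(e \<longlongrightarrow> 0) at_top"
      by (rule Lim_transform_eventually)
    ultimately show ?thesis
      using sgn_tanh_flow[OF assms(1,2)] abs_tanh_flow_le[OF assms(1,2)] c_def[symmetric] e by simp
  qed
  moreover have "lyapunov_stable F 0"
    unfolding lyapunov_stable_def
  proof (intro allI impI)
    fix \<epsilon> :: real
    assume "\<epsilon> > 0"
    then show "\<exists>\<delta>>0. \<forall>x. ode_solution_on F {0..} x \<and> \<bar>x 0 - 0\<bar> < \<delta> \<longrightarrow> (\<forall>t\<ge>0. \<bar>x t - 0\<bar> < \<epsilon>)"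
      \<comment> \<open>As \<bar>x t\<bar> never exceeds \<bar>x 0\<bar>, \<delta> = \<epsilon>
        works.\<close>
      using props by (intro exI[of _ \<epsilon>]) (auto intro: order_le_less_trans)
  qed
  moreover have "F 0 = 0"
    by (simp add: F)
  ultimately show ?thesis
    unfolding globally_asymptotically_stable_def by blast
qed

end
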